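(* Let $M$ be a matroid. The reduced motivic zeta function of $M$ satisfies the functional equation \[ \overline{Z}_M(q^{-1}, T^{-1}) = q^{\operatorname{rk} M - 1}\, \overline{Z}_M(q,T). \]
   Context: Let $M$ be a matroid on a finite non-empty ground set $E$ with rank function $\operatorname{rk}$, characteristic polynomial $\chi_M(q)=\sum_{S\subseteq E}(-1)^{\#S}q^{\operatorname{rk}M-\operatorname{rk}S}$ and reduced characteristic polynomial $\overline{\chi}_M(q)=\chi_M(q)/(q-1)$. For $w\in\mathbb{R}^E$ set $\operatorname{wt}_M(w)=\max_{B\text{ basis}}\sum_{e\in B}w_e$ and let $M_w$ be the matroid on $E$ whose bases are the bases attaining this maximum. For $v\in\mathbb{R}^E/\mathbb{R}\mathbf{1}$ with lift $w$, set $\overline{\operatorname{wt}}_M(v)=\operatorname{wt}_M(w)-(\operatorname{rk}M)\min(w)$, $\overline{|v|}=\sum_e w_e-(\#E)\min(w)$, $M_v=M_w$. The reduced motivic zeta function is $\overline{Z}_M(q,T)=\sum_{v\in\mathbb{Z}^E/\mathbb{Z}\mathbf{1}}\overline{\chi}_{M_v}(q)q^{-(\operatorname{rk}M-1)-\overline{\operatorname{wt}}_M(v)}T^{\overline{|v|}}$. It is a rational function of $q,T$, and the identity is understood in the field $\mathbb{Q}(q)(T)$. *)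

theory Defs
  imports "HOL-Computational_Algebra.Computational_Algebra" "HOL-Library.FuncSet"
begin

locale matroid =
  fixes E :: "'a set" and \<B> :: "'a set set"
  assumes finite_ground: "finite E"
    and bases_subset: "\<B> \<subseteq> Pow E"
    and bases_nonempty: "\<B> \<noteq> {}"
    and basis_exchange:
      "\<lbrakk>B\<^sub>1 \<in> \<B>; B\<^sub>2 \<in> \<B>; x \<in> B\<^sub>1 - B\<^sub>2\<rbrakk> \<Longrightarrow> \<exists>y \<in> B\<^sub>2 - B\<^sub>1. insert y (B\<^sub>1 - {x}) \<in> \<B>"

definition rk :: "'a set set \<Rightarrow> 'a set \<Rightarrow> nat" where
  "rk \<B> S = Max ((\<lambda>B. card (B \<inter> S)) ` \<B>)"

text \<open>The subtraction does not truncate: \<open>rk \<B> S \<le> rk \<B> E\<close> for \<open>S \<subseteq> E\<close>.\<close>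

definition matroid_char_poly :: "'a set \<Rightarrow> 'a set set \<Rightarrow> rat poly" where
  "matroid_char_poly E \<B> = (\<Sum>S\<in>Pow E. monom ((-1) ^ card S) (rk \<B> E - rk \<B> S))"

text \<open>For a matroid on a non-empty ground set the division is exact; see
  \<open>reduced_char_poly_mult\<close> below.\<close>

definition reduced_char_poly :: "'a set \<Rightarrow> 'a set set \<Rightarrow> rat poly" where
  "reduced_char_poly E \<B> = matroid_char_poly E \<B> div [:-1, 1:]"

lemma reduced_char_poly_mult:
  assumes "finite E" "E \<noteq> {}"
  shows "[:-1, 1:] * reduced_char_poly E \<B> = matroid_char_poly E \<B>"
proof -
  from assms obtain e where e: "e \<in> E" by blast
  have fin: "finite (E - {e})" using assms by simp
  have split: "Pow E = Pow (E - {e}) \<union> insert e ` Pow (E - {e})"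
    using e by (metis Pow_insert insert_Diff)
  have "poly (matroid_char_poly E \<B>) 1 = (\<Sum>S\<in>Pow E. (-1) ^ card S)"
    by (simp add: matroid_char_poly_def poly_sum poly_monom)
  also have "\<dots> = (\<Sum>S\<in>Pow (E - {e}). (-1) ^ card S)
      + (\<Sum>S\<in>insert e ` Pow (E - {e}). (-1) ^ card S)"
    unfolding split by (rule sum.union_disjoint) (use fin in auto)
  also have "(\<Sum>S\<in>insert e ` Pow (E - {e}). (-1) ^ card S)
      = (\<Sum>S\<in>Pow (E - {e}). (-1 :: rat) ^ card (insert e S))"
    by (subst sum.reindex) (auto simp: inj_on_def)
  also have "\<dots> = (\<Sum>S\<in>Pow (E - {e}). - ((-1 :: rat) ^ card S))"
  proof (rule sum.cong[OF refl])
    fix S assume "S \<in> Pow (E - {e})"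
    then have "finite S" "e \<notin> S" using fin finite_subset by auto
    then show "(-1 :: rat) ^ card (insert e S) = - ((-1) ^ card S)" by simp
  qed
  finally have "poly (matroid_char_poly E \<B>) 1 = 0" by (simp add: sum_negf)
  then have "[:-1, 1:] dvd matroid_char_poly E \<B>" by (simp add: poly_eq_0_iff_dvd)
  then show ?thesis unfolding reduced_char_poly_def by (rule dvd_mult_div_cancel)
qed

definition wt :: "'a set set \<Rightarrow> ('a \<Rightarrow> 'b::linordered_idom) \<Rightarrow> 'b" where
  "wt \<B> w = Max ((\<lambda>B. \<Sum>e\<in>B. w e) ` \<B>)"

definition initial_bases :: "'a set set \<Rightarrow> ('a \<Rightarrow> 'b::linordered_idom) \<Rightarrow> 'a set set" where
  "initial_bases \<B> w = {B \<in> \<B>. (\<Sum>e\<in>B. w e) = wt \<B> w}"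

definition reduced_wt :: "'a set \<Rightarrow> 'a set set \<Rightarrow> ('a \<Rightarrow> 'b::linordered_idom) \<Rightarrow> 'b" where
  "reduced_wt E \<B> w = wt \<B> w - of_nat (rk \<B> E) * Min (w ` E)"

definition reduced_size :: "'a set \<Rightarrow> ('a \<Rightarrow> 'b::linordered_idom) \<Rightarrow> 'b" where
  "reduced_size E w = (\<Sum>e\<in>E. w e) - of_nat (card E) * Min (w ` E)"

definition int_lattice :: "'a set \<Rightarrow> ('a \<Rightarrow> int) set" where
  "int_lattice E = (E \<rightarrow>\<^sub>E UNIV)"

definition shift_rel :: "'a set \<Rightarrow> (('a \<Rightarrow> int) \<times> ('a \<Rightarrow> int)) set" where
  "shift_rel E = {(w, w'). w \<in> int_lattice E \<and> w' \<in> int_lattice E \<and> (\<exists>c. \<forall>e\<in>E. w' e = w e + c)}"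

definition int_lattice_mod_ones :: "'a set \<Rightarrow> ('a \<Rightarrow> int) set set" where
  "int_lattice_mod_ones E = int_lattice E // shift_rel E"

definition lift :: "('a \<Rightarrow> int) set \<Rightarrow> 'a \<Rightarrow> int" where
  "lift v = (SOME w. w \<in> v)"

lemma equiv_shift_rel: "equiv (int_lattice E) (shift_rel E)"
proof (rule equivI)
  show "shift_rel E \<subseteq> int_lattice E \<times> int_lattice E" by (auto simp: shift_rel_def)
  show "refl_on (int_lattice E) (shift_rel E)"
    by (auto simp: refl_on_def shift_rel_def intro: exI[of _ 0])
  show "sym (shift_rel E)"
  proof (rule symI)
    fix w w' assume "(w, w') \<in> shift_rel E"
    then obtain c where c: "\<forall>e\<in>E. w' e = w e + c" "w \<in> int_lattice E" "w' \<in> int_lattice E"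
      by (auto simp: shift_rel_def)
    have "\<forall>e\<in>E. w e = w' e + (- c)" using c by simp
    then show "(w', w) \<in> shift_rel E" using c unfolding shift_rel_def by blast
  qed
  show "trans (shift_rel E)"
  proof (rule transI)
    fix u w x assume *: "(u, w) \<in> shift_rel E" "(w, x) \<in> shift_rel E"
    obtain c where "\<forall>e\<in>E. w e = u e + c" using *(1) by (auto simp: shift_rel_def)
    moreover obtain d where "\<forall>e\<in>E. x e = w e + d" using *(2) by (auto simp: shift_rel_def)
    moreover have "u \<in> int_lattice E" "x \<in> int_lattice E" using * by (auto simp: shift_rel_def)
    ultimately have c: "\<forall>e\<in>E. w e = u e + c" "\<forall>e\<in>E. x e = w e + d"
        "u \<in> int_lattice E" "x \<in> int_lattice E" by auto
    have "\<forall>e\<in>E. x e = u e + (c + d)" using c by simp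
    then show "(u, x) \<in> shift_rel E" using c unfolding shift_rel_def by blast
  qed
qed

text \<open>The choice of lift is immaterial.\<close>

lemma Min_shift:
  fixes w w' :: "'a \<Rightarrow> int"
  assumes "finite E" "E \<noteq> {}" "\<forall>e\<in>E. w' e = w e + c"
  shows "Min (w' ` E) = Min (w ` E) + c"
proof -
  have "w' ` E = (\<lambda>e. w e + c) ` E" using assms(3) by (auto intro: image_cong)
  then show ?thesis using Min_add_commute[OF assms(1,2), of w c] by simp
qed

lemma reduced_size_shift:
  assumes "finite E" "E \<noteq> {}" "(w, w') \<in> shift_rel E"
  shows "reduced_size E w' = reduced_size E w"
proof -
  obtain c where c: "\<forall>e\<in>E. w' e = w e + c" using assms(3) by (auto simp: shift_rel_def)
  have "(\<Sum>e\<in>E. w' e) = (\<Sum>e\<in>E. w e + c)" using c by (intro sum.cong) auto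
  then show ?thesis
    by (simp add: reduced_size_def Min_shift[OF assms(1,2) c] sum.distrib algebra_simps)
qed

context matroid
begin

lemma finite_bases: "finite \<B>"
  using finite_ground bases_subset finite_subset by blast

lemma finite_basis: "B \<in> \<B> \<Longrightarrow> finite B"
  using finite_ground bases_subset finite_subset by blast

lemma card_basis_le:
  assumes "B\<^sub>1 \<in> \<B>" "B\<^sub>2 \<in> \<B>"
  shows "card B\<^sub>1 \<le> card B\<^sub>2"
  using assms
proof (induction "card (B\<^sub>1 - B\<^sub>2)" arbitrary: B\<^sub>1)
  case 0
  then have "B\<^sub>1 - B\<^sub>2 = {}" using finite_basis by simp
  then show ?case using 0 finite_basis by (intro card_mono) auto
next
  case (Suc n)
  then obtain x where x: "x \<in> B\<^sub>1 - B\<^sub>2"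
    by (metis card.empty ex_in_conv nat.distinct(1))
  then obtain y where y: "y \<in> B\<^sub>2 - B\<^sub>1" "insert y (B\<^sub>1 - {x}) \<in> \<B>"
    using basis_exchange[OF Suc.prems x] by blast
  have f: "finite B\<^sub>1" using Suc.prems finite_basis by simp
  have "insert y (B\<^sub>1 - {x}) - B\<^sub>2 = (B\<^sub>1 - B\<^sub>2) - {x}" using y by auto
  then have "card (insert y (B\<^sub>1 - {x}) - B\<^sub>2) = n" using x f Suc.hyps(2) by simp
  then have "card (insert y (B\<^sub>1 - {x})) \<le> card B\<^sub>2"
    using Suc.hyps(1)[of "insert y (B\<^sub>1 - {x})"] y(2) Suc.prems(2) by simp
  moreover have "card (insert y (B\<^sub>1 - {x})) = card B\<^sub>1"
    using x y f by (metis Diff_iff card_insert_disjoint card.remove finite_Diff)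
  ultimately show ?case by simp
qed

lemma card_basis:
  assumes "B \<in> \<B>"
  shows "card B = rk \<B> E"
proof -
  have "card (B' \<inter> E) = card B" if "B' \<in> \<B>" for B'
    using that assms bases_subset card_basis_le
    by (metis PowD inf.absorb1 le_antisym subsetD)
  then have "(\<lambda>B'. card (B' \<inter> E)) ` \<B> = {card B}" using assms by (auto simp: image_iff)
  then show ?thesis by (simp add: rk_def)
qed

lemma sum_basis_shift:
  assumes "B \<in> \<B>" "\<forall>e\<in>E. w' e = w e + (c::int)"
  shows "(\<Sum>e\<in>B. w' e) = (\<Sum>e\<in>B. w e) + int (rk \<B> E) * c"
proof -
  have "(\<Sum>e\<in>B. w' e) = (\<Sum>e\<in>B. w e + c)"
    using assms bases_subset by (intro sum.cong) auto
  then show ?thesis using card_basis[OF assms(1)] by (simp add: sum.distrib)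
qed

lemma wt_shift:
  assumes "\<forall>e\<in>E. w' e = w e + (c::int)"
  shows "wt \<B> w' = wt \<B> w + int (rk \<B> E) * c"
proof -
  have "(\<lambda>B. \<Sum>e\<in>B. w' e) ` \<B> = (\<lambda>B. (\<Sum>e\<in>B. w e) + int (rk \<B> E) * c) ` \<B>"
    using sum_basis_shift assms by (intro image_cong) auto
  then show ?thesis
    using Max_add_commute[OF finite_bases bases_nonempty] by (simp add: wt_def)
qed

lemma reduced_wt_shift:
  assumes "E \<noteq> {}" "(w, w') \<in> shift_rel E"
  shows "reduced_wt E \<B> w' = reduced_wt E \<B> w"
proof -
  obtain c where c: "\<forall>e\<in>E. w' e = w e + c" using assms(2) by (auto simp: shift_rel_def)
  show ?thesis
    by (simp add: reduced_wt_def wt_shift[OF c] Min_shift[OF finite_ground assms(1) c] algebra_simps)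
qed

lemma initial_bases_shift:
  assumes "(w, w') \<in> shift_rel E"
  shows "initial_bases \<B> w' = initial_bases \<B> w"
proof -
  obtain c where c: "\<forall>e\<in>E. w' e = w e + c" using assms by (auto simp: shift_rel_def)
  show ?thesis using sum_basis_shift[OF _ c] by (auto simp: initial_bases_def wt_shift[OF c])
qed

end

lemma lift_in:
  assumes "v \<in> int_lattice_mod_ones E"
  shows "lift v \<in> v"
  using assms in_quotient_imp_non_empty[OF equiv_shift_rel] unfolding lift_def int_lattice_mod_ones_def
  by (metis some_in_eq)

lemma lift_shift_rel:
  assumes "v \<in> int_lattice_mod_ones E" "w \<in> v"
  shows "(lift v, w) \<in> shift_rel E"
  using lift_in[OF assms(1)] assms quotient_eq_iff[OF equiv_shift_rel]
  unfolding int_lattice_mod_ones_def by metis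

text \<open>The field \<open>\<rat>(q)\<close> is \<open>rat poly fract\<close>, and \<open>\<rat>(q)(T)\<close> is \<open>rat poly fract poly fract\<close>.\<close>

definition var_q :: "rat poly fract" where
  "var_q = to_fract [:0, 1:]"

definition zeta_term :: "'a set \<Rightarrow> 'a set set \<Rightarrow> ('a \<Rightarrow> int) \<Rightarrow> rat poly fract" where
  "zeta_term E \<B> w = to_fract (reduced_char_poly E (initial_bases \<B> w))
     * var_q powi (- (int (rk \<B> E) - 1) - reduced_wt E \<B> w)"

text \<open>The sum over the quotient lattice is a formal power series in \<open>T\<close>. Only finitely many classes
  contribute to each coefficient; see \<open>finite_reduced_size\<close>.\<close>

definition zeta_series :: "'a set \<Rightarrow> 'a set set \<Rightarrow> rat poly fract fps" where
  "zeta_series E \<B> = Abs_fps (\<lambda>n.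
     \<Sum>v | v \<in> int_lattice_mod_ones E \<and> reduced_size E (lift v) = int n. zeta_term E \<B> (lift v))"

lemma finite_reduced_size:
  assumes "finite E" "E \<noteq> {}"
  shows "finite {v. v \<in> int_lattice_mod_ones E \<and> reduced_size E (lift v) = int n}"
proof (rule finite_subset)
  show "finite ((\<lambda>w. shift_rel E `` {w}) ` (E \<rightarrow>\<^sub>E {0..int n}))"
    using assms by (intro finite_imageI finite_PiE) auto
  show "{v. v \<in> int_lattice_mod_ones E \<and> reduced_size E (lift v) = int n}
      \<subseteq> (\<lambda>w. shift_rel E `` {w}) ` (E \<rightarrow>\<^sub>E {0..int n})"
  proof clarify
    fix v assume v: "v \<in> int_lattice_mod_ones E" and n: "reduced_size E (lift v) = int n"
    define m where "m = Min (lift v ` E)"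
    define w where "w = (\<lambda>e\<in>E. lift v e - m)"
    have v': "v \<in> int_lattice E // shift_rel E" using v by (simp add: int_lattice_mod_ones_def)
    have l: "lift v \<in> int_lattice E"
      using lift_shift_rel[OF v lift_in[OF v]] by (simp add: shift_rel_def)
    have nonneg: "0 \<le> w e" if "e \<in> E" for e using that assms by (simp add: w_def m_def)
    have "(\<Sum>e\<in>E. w e) = int n"
      using n by (simp add: w_def reduced_size_def m_def sum_subtractf)
    then have "w e \<le> int n" if "e \<in> E" for e
      using member_le_sum[of e E w] that nonneg assms by auto
    then have "w \<in> E \<rightarrow>\<^sub>E {0..int n}" using nonneg by (auto simp: w_def)
    moreover have "(lift v, w) \<in> shift_rel E"
      using l by (auto simp: shift_rel_def int_lattice_def w_def intro!: exI[of _ "- m"])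
    then have "v = shift_rel E `` {w}"
      using v' lift_in[OF v] equiv_shift_rel
      by (metis Image_singleton_iff equiv_class_eq quotientE)
    ultimately show "v \<in> (\<lambda>w. shift_rel E `` {w}) ` (E \<rightarrow>\<^sub>E {0..int n})" by blast
  qed
qed

text \<open>The relation \<open>expands_to R f\<close> says that \<open>R\<close> and \<open>f\<close> have the same image in the field of formal
  Laurent series in \<open>T\<close>.\<close>

definition expands_to :: "'k::field poly fract \<Rightarrow> 'k fps \<Rightarrow> bool" where
  "expands_to R f \<longleftrightarrow> (\<exists>N D. D \<noteq> 0 \<and> R = Fraction_Field.Fract N D \<and> fps_of_poly D * f = fps_of_poly N)"

lemma expands_to_unique:
  assumes "expands_to R f" "expands_to R' f"
  shows "R = R'"
proof -
  obtain N D where 1: "D \<noteq> 0" "R = Fraction_Field.Fract N D" "fps_of_poly D * f = fps_of_poly N"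
    using assms(1) by (auto simp: expands_to_def)
  obtain N' D' where 2: "D' \<noteq> 0" "R' = Fraction_Field.Fract N' D'" "fps_of_poly D' * f = fps_of_poly N'"
    using assms(2) by (auto simp: expands_to_def)
  have "fps_of_poly (N * D') = fps_of_poly (N' * D)"
    by (simp add: fps_of_poly_mult 1(3)[symmetric] 2(3)[symmetric] mult_ac)
  then have "N * D' = N' * D" by (simp only: fps_of_poly_eq_iff)
  then show ?thesis using 1 2 by (simp add: eq_fract)
qed

definition reduced_zeta :: "'a set \<Rightarrow> 'a set set \<Rightarrow> rat poly fract poly fract" where
  "reduced_zeta E \<B> = (THE R. expands_to R (zeta_series E \<B>))"

text \<open>Extension of a ring homomorphism to the fraction field; it is meaningful for injective
  homomorphisms, see \<open>fract_ext_Fract\<close>.\<close>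

definition fract_ext :: "('a::idom \<Rightarrow> 'b::field) \<Rightarrow> 'a fract \<Rightarrow> 'b" where
  "fract_ext h r = (THE y. \<exists>a b. b \<noteq> 0 \<and> r = Fraction_Field.Fract a b \<and> y = h a / h b)"

text \<open>The polynomial \<open>p = \<Sum> c\<^sub>i X\<^sup>i\<close> is sent to \<open>\<Sum> \<sigma>(c\<^sub>i) X\<^sup>-\<^sup>i\<close>.\<close>

definition poly_invert :: "('k::field \<Rightarrow> 'k) \<Rightarrow> 'k poly \<Rightarrow> 'k poly fract" where
  "poly_invert \<sigma> p = poly (map_poly (\<lambda>c. to_fract [:\<sigma> c:]) p) (inverse (to_fract [:0, 1:]))"

definition invert_q :: "rat poly fract \<Rightarrow> rat poly fract" where
  "invert_q = fract_ext (poly_invert (\<lambda>c. c))"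

definition invert_qT :: "rat poly fract poly fract \<Rightarrow> rat poly fract poly fract" where
  "invert_qT = fract_ext (poly_invert invert_q)"

definition const_T :: "rat poly fract \<Rightarrow> rat poly fract poly fract" where
  "const_T c = to_fract [:c:]"

definition var_T :: "rat poly fract poly fract" where
  "var_T = to_fract [:0, 1:]"

locale inj_ring_hom =
  fixes h :: "'a::idom \<Rightarrow> 'b::idom"
  assumes hom_add: "h (x + y) = h x + h y"
    and hom_mult: "h (x * y) = h x * h y"
    and hom_one: "h 1 = 1"
    and hom_inj: "h x = 0 \<Longrightarrow> x = 0"
begin

lemma hom_zero: "h 0 = 0"
  using hom_add[of 0 0] by (metis add.right_neutral add_left_cancel)

end

lemma fract_ext_Fract:
  assumes "inj_ring_hom h" "b \<noteq> 0"
  shows "fract_ext h (Fraction_Field.Fract a b) = h a / h b"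
  unfolding fract_ext_def
proof (rule the_equality)
  interpret inj_ring_hom h by fact
  show "\<exists>a' b'. b' \<noteq> 0 \<and> Fraction_Field.Fract a b = Fraction_Field.Fract a' b' \<and> h a / h b = h a' / h b'"
    using assms(2) by blast
  fix y assume "\<exists>a' b'. b' \<noteq> 0 \<and> Fraction_Field.Fract a b = Fraction_Field.Fract a' b' \<and> y = h a' / h b'"
  then obtain a' b' where *: "b' \<noteq> 0" "Fraction_Field.Fract a b = Fraction_Field.Fract a' b'" "y = h a' / h b'"
    by blast
  then have "a * b' = a' * b" using assms(2) by (simp add: eq_fract)
  then have "h a * h b' = h a' * h b" by (metis hom_mult)
  moreover have "h b \<noteq> 0" "h b' \<noteq> 0" using assms(2) * hom_inj by auto
  ultimately show "y = h a / h b" unfolding *(3) by (simp add: frac_eq_eq)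
qed

lemma inj_ring_hom_fract_ext:
  assumes "inj_ring_hom h"
  shows "inj_ring_hom (fract_ext h)"
proof -
  interpret inj_ring_hom h by fact
  note ext = fract_ext_Fract[OF assms]
  have nz: "h b \<noteq> 0" if "b \<noteq> 0" for b using that hom_inj by auto
  show ?thesis
  proof
    fix x y :: "'a fract"
    obtain a b where x: "x = Fraction_Field.Fract a b" "b \<noteq> 0" by (cases x)
    obtain c d where y: "y = Fraction_Field.Fract c d" "d \<noteq> 0" by (cases y)
    show "fract_ext h (x + y) = fract_ext h x + fract_ext h y"
      using x y nz by (simp add: ext hom_add hom_mult field_simps)
    show "fract_ext h (x * y) = fract_ext h x * fract_ext h y"
      using x y nz by (simp add: ext hom_mult)
    show "fract_ext h 1 = 1"
      by (simp add: One_fract_def ext hom_one)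
    show "x = 0" if "fract_ext h x = 0"
      using that x nz[of b] hom_inj[of a] by (auto simp: ext Zero_fract_def eq_fract)
  qed
qed

lemma inj_ring_hom_poly_invert:
  assumes "inj_ring_hom \<sigma>"
  shows "inj_ring_hom (poly_invert \<sigma>)"
proof -
  interpret inj_ring_hom \<sigma> by fact
  define X :: "'a poly fract" where "X = to_fract [:0, 1:]"
  have X: "X \<noteq> 0" by (simp add: X_def)
  have cst: "to_fract [:\<sigma> (a + b):] = to_fract [:\<sigma> a:] + to_fract [:\<sigma> b:]"
     "to_fract [:\<sigma> (a * b):] = to_fract [:\<sigma> a:] * to_fract [:\<sigma> b:]" for a b
    by (simp_all add: hom_add hom_mult flip: to_fract_add to_fract_mult)
  have pC: "poly_invert \<sigma> (pCons a p) = to_fract [:\<sigma> a:] + inverse X * poly_invert \<sigma> p" for a p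
    by (simp add: poly_invert_def X_def map_poly_pCons hom_zero)
  have zero: "poly_invert \<sigma> 0 = 0" by (simp add: poly_invert_def)
  have add: "poly_invert \<sigma> (p + r) = poly_invert \<sigma> p + poly_invert \<sigma> r" for p r
    by (induction p r rule: poly_induct2) (simp_all add: pC zero cst algebra_simps)
  have smult: "poly_invert \<sigma> (smult a p) = to_fract [:\<sigma> a:] * poly_invert \<sigma> p" for a p
    by (induction p) (simp_all add: pC zero cst algebra_simps)
  have mult: "poly_invert \<sigma> (p * r) = poly_invert \<sigma> p * poly_invert \<sigma> r" for p r
    by (induction p) (simp_all add: pC zero add smult hom_zero algebra_simps)
  have at_X: "poly (map_poly (\<lambda>c. to_fract [:c:]) p) X = to_fract p" for p :: "'a poly"
  proof (induction p)
    case (pCons a p)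
    have "to_fract (pCons a p) = to_fract [:a:] + X * to_fract p"
      by (simp add: X_def flip: to_fract_add to_fract_mult)
    then show ?case using pCons by (simp add: map_poly_pCons)
  qed simp
  show ?thesis
  proof
    show "poly_invert \<sigma> 1 = 1"
      by (simp add: one_pCons pC zero hom_one) (simp flip: one_pCons)
    show "p = 0" if "poly_invert \<sigma> p = 0" for p
    proof -
      define r where "r = map_poly \<sigma> p"
      define r' where "r' = map_poly (\<lambda>c. to_fract [:c:]) r"
      have "r' = map_poly (\<lambda>c. to_fract [:\<sigma> c:]) p"
        by (simp add: r'_def r_def map_poly_map_poly hom_zero o_def)
      then have "poly r' (inverse X) = 0" using that by (simp add: poly_invert_def X_def)
      then have "poly (reflect_poly r') X = 0" by (simp add: poly_reflect_poly_nz X)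
      moreover have "reflect_poly r' = map_poly (\<lambda>c. to_fract [:c:]) (reflect_poly r)"
      proof (rule poly_eqI)
        have "degree r' = degree r" unfolding r'_def by (rule degree_map_poly) simp
        then show "coeff (reflect_poly r') i = coeff (map_poly (\<lambda>c. to_fract [:c:]) (reflect_poly r)) i" for i
          by (simp add: coeff_reflect_poly coeff_map_poly) (simp add: r'_def coeff_map_poly)
      qed
      ultimately have "to_fract (reflect_poly r) = 0" by (simp add: at_X)
      then have "r = 0" by simp
      then show "p = 0"
        by (intro poly_eqI) (metis coeff_0 coeff_map_poly hom_inj hom_zero r_def)
    qed
  qed (simp_all add: add mult)
qed

lemma inj_ring_hom_invert_q: "inj_ring_hom invert_q"
  unfolding invert_q_def
  by (intro inj_ring_hom_fract_ext inj_ring_hom_poly_invert) (unfold_locales, auto)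

lemma inj_ring_hom_invert_qT: "inj_ring_hom invert_qT"
  unfolding invert_qT_def
  by (intro inj_ring_hom_fract_ext inj_ring_hom_poly_invert inj_ring_hom_invert_q)

lemma fract_ext_to_fract:
  assumes "inj_ring_hom h"
  shows "fract_ext h (to_fract a) = h a"
  using fract_ext_Fract[OF assms, of 1 a] inj_ring_hom.hom_one[OF assms] by (simp add: to_fract_def)

lemma invert_q_var_q: "invert_q var_q = inverse var_q"
proof -
  have h: "inj_ring_hom (poly_invert (\<lambda>c::rat. c))"
    by (intro inj_ring_hom_poly_invert) (unfold_locales, auto)
  have "poly_invert (\<lambda>c. c) [:0, 1::rat:] = inverse var_q"
    by (simp add: poly_invert_def var_q_def map_poly_pCons) (simp flip: one_pCons)
  then show ?thesis by (simp add: invert_q_def var_q_def fract_ext_to_fract[OF h])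
qed

lemma invert_qT_const_T: "invert_qT (const_T c) = const_T (invert_q c)"
proof -
  interpret inj_ring_hom invert_q by (rule inj_ring_hom_invert_q)
  have h: "inj_ring_hom (poly_invert invert_q)"
    by (intro inj_ring_hom_poly_invert inj_ring_hom_invert_q)
  show ?thesis
    by (simp add: invert_qT_def const_T_def fract_ext_to_fract[OF h] poly_invert_def
        map_poly_pCons hom_zero)
qed

lemma invert_qT_var_T: "invert_qT var_T = inverse var_T"
proof -
  interpret inj_ring_hom invert_q by (rule inj_ring_hom_invert_q)
  have h: "inj_ring_hom (poly_invert invert_q)"
    by (intro inj_ring_hom_poly_invert inj_ring_hom_invert_q)
  have "poly_invert invert_q [:0, 1:] = inverse var_T"
    by (simp add: poly_invert_def var_T_def map_poly_pCons hom_zero hom_one) (simp flip: one_pCons)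
  then show ?thesis by (simp add: invert_qT_def var_T_def fract_ext_to_fract[OF h])
qed

end

(*
  Expand the zeta function over lifts w with values in the natural numbers and peel off the support H
  of w: writing w = w' + 1_H, the initial matroid of w splits off the minor with lattice of subsets
  [H, G], and the weight drops by rk H. With W_G the sum over all w supported on G and
  Y_G = q^(- rk G) T^|G| W_G the part with full support, this gives
  W_G = sum_{H <= G} chi_[H,G](q) Y_H. As chi_[H,G] is the convolution of the Moebius function of the
  Boolean lattice with q^(rk G - rk U), the series V_U = sum_{H <= U} (-1)^|U - H| Y_H satisfies
    Y_G = sum_{U <= G} V_U,   W_G = q^(rk G) sum_{U <= G} q^(- rk U) V_U.
  Together with the definition of Y_G this determines V recursively, and induction shows that V_U is
  rational and that inverting q and T multiplies it by q^(- rk U). The reduced zeta function is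
  q^(1 - rk E) (W_E - Y_E) / (q - 1), and inversion exchanges the two sums above for G = E. Loops
  and flats need no separate treatment, since the characteristic polynomial of a matroid with loops is 0.
*)

theory Submission
  imports Defs
begin

subsection \<open>Rational functions and their expansions\<close>

context inj_ring_hom
begin

lemma hom_uminus: "h (- x) = - h x"
  using hom_add[of x "- x"] by (simp add: hom_zero eq_neg_iff_add_eq_0 add.commute)

lemma hom_diff: "h (x - y) = h x - h y"
  using hom_add[of x "- y"] by (simp add: hom_uminus)

lemma hom_power: "h (x ^ n) = h x ^ n"
  by (induction n) (simp_all add: hom_one hom_mult)

lemma hom_sum: "h (\<Sum>i\<in>I. f i) = (\<Sum>i\<in>I. h (f i))"
  by (induction I rule: infinite_finite_induct) (simp_all add: hom_zero hom_add)

end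

lemma inj_ring_hom_inverse:
  fixes h :: "'a::field \<Rightarrow> 'b::field"
  assumes "inj_ring_hom h"
  shows "h (inverse x) = inverse (h x)"
proof (cases "x = 0")
  case True
  then show ?thesis by (simp add: inj_ring_hom.hom_zero[OF assms])
next
  case False
  then have "h x * h (inverse x) = 1"
    by (metis assms inj_ring_hom.hom_mult inj_ring_hom.hom_one right_inverse)
  then show ?thesis by (simp add: inverse_unique)
qed

lemma inj_ring_hom_divide:
  fixes h :: "'a::field \<Rightarrow> 'b::field"
  assumes "inj_ring_hom h"
  shows "h (x / y) = h x / h y"
  by (simp add: divide_inverse inj_ring_hom.hom_mult[OF assms] inj_ring_hom_inverse[OF assms])

lemma inj_ring_hom_power_int:
  fixes h :: "'a::field \<Rightarrow> 'b::field"
  assumes "inj_ring_hom h"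
  shows "h (x powi k) = h x powi k"
  by (simp add: power_int_def inj_ring_hom.hom_power[OF assms] inj_ring_hom_inverse[OF assms])

lemma inj_ring_hom_const_T: "inj_ring_hom const_T"
  by unfold_locales
    (simp_all add: const_T_def flip: to_fract_add to_fract_mult one_pCons)

lemma inj_ring_hom_to_fract: "inj_ring_hom to_fract"
  by unfold_locales simp_all

lemma var_q_nonzero: "var_q \<noteq> 0"
  by (simp add: var_q_def)

lemma var_T_nonzero: "var_T \<noteq> 0"
  by (simp add: var_T_def)

lemma invert_q_powi: "invert_q (var_q powi k) = var_q powi (- k)"
  by (simp add: inj_ring_hom_power_int[OF inj_ring_hom_invert_q] invert_q_var_q
      power_int_inverse power_int_minus)

lemma to_fract_monom: "to_fract (monom c n) = const_T c * var_T ^ n"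
proof -
  have "monom c n = [:c:] * [:0, 1:] ^ n" by (simp add: monom_altdef)
  then show ?thesis
    by (simp only: const_T_def var_T_def to_fract_mult inj_ring_hom.hom_power[OF inj_ring_hom_to_fract])
qed

section \<open>Arithmetic of expansions in \<open>T\<close>\<close>

lemma expands_to_fps_of_poly: "expands_to (to_fract p) (fps_of_poly p)"
  unfolding expands_to_def by (intro exI[of _ p] exI[of _ 1]) (simp add: to_fract_def)

lemma expands_to_const: "expands_to (const_T c) (fps_const c)"
  using expands_to_fps_of_poly[of "[:c:]"] by (simp add: const_T_def fps_of_poly_const)

lemma expands_to_X_power: "expands_to (var_T ^ n) (fps_X ^ n)"
  using expands_to_fps_of_poly[of "monom (1 :: rat poly fract) n"]
  by (simp add: to_fract_monom fps_of_poly_monom' inj_ring_hom.hom_one[OF inj_ring_hom_const_T])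

lemma expands_to_add:
  assumes "expands_to R f" "expands_to R' f'"
  shows "expands_to (R + R') (f + f')"
proof -
  obtain N D N' D' where *: "D \<noteq> 0" "R = Fraction_Field.Fract N D" "fps_of_poly D * f = fps_of_poly N"
     "D' \<noteq> 0" "R' = Fraction_Field.Fract N' D'" "fps_of_poly D' * f' = fps_of_poly N'"
    using assms unfolding expands_to_def by metis
  have "fps_of_poly (D * D') * (f + f')
      = (fps_of_poly D * f) * fps_of_poly D' + (fps_of_poly D' * f') * fps_of_poly D"
    by (simp add: fps_of_poly_mult algebra_simps)
  also have "\<dots> = fps_of_poly (N * D' + N' * D)"
    unfolding *(3,6) by (simp add: fps_of_poly_mult fps_of_poly_add)
  finally show ?thesis
    using * unfolding expands_to_def
    by (intro exI[of _ "N * D' + N' * D"] exI[of _ "D * D'"]) simp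
qed

lemma expands_to_mult:
  assumes "expands_to R f" "expands_to R' f'"
  shows "expands_to (R * R') (f * f')"
proof -
  obtain N D N' D' where *: "D \<noteq> 0" "R = Fraction_Field.Fract N D" "fps_of_poly D * f = fps_of_poly N"
     "D' \<noteq> 0" "R' = Fraction_Field.Fract N' D'" "fps_of_poly D' * f' = fps_of_poly N'"
    using assms unfolding expands_to_def by metis
  have "fps_of_poly (D * D') * (f * f') = (fps_of_poly D * f) * (fps_of_poly D' * f')"
    by (simp add: fps_of_poly_mult algebra_simps)
  also have "\<dots> = fps_of_poly (N * N')"
    unfolding *(3,6) by (simp add: fps_of_poly_mult)
  finally show ?thesis
    using * unfolding expands_to_def
    by (intro exI[of _ "N * N'"] exI[of _ "D * D'"]) simp
qed

lemma expands_to_uminus: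
  fixes R :: "rat poly fract poly fract"
  assumes "expands_to R f"
  shows "expands_to (- R) (- f)"
  using expands_to_mult[OF expands_to_const[of "-1"] assms]
  by (simp add: inj_ring_hom.hom_uminus[OF inj_ring_hom_const_T]
      inj_ring_hom.hom_one[OF inj_ring_hom_const_T] flip: fps_const_neg)

lemma expands_to_diff:
  fixes R :: "rat poly fract poly fract"
  assumes "expands_to R f" "expands_to R' f'"
  shows "expands_to (R - R') (f - f')"
  using expands_to_add[OF assms(1) expands_to_uminus[OF assms(2)]] by simp

lemma expands_to_sum:
  assumes "\<And>i. i \<in> I \<Longrightarrow> expands_to (R i) (f i)"
  shows "expands_to (\<Sum>i\<in>I. R i) (\<Sum>i\<in>I. f i)"
  using assms
proof (induction I rule: infinite_finite_induct)
  case (insert i I)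
  then show ?case by (simp add: expands_to_add)
qed (use expands_to_fps_of_poly[of 0] in simp_all)

text \<open>The factor \<open>p\<close> is absorbed into the denominator. In this way a linear
  equation for a series yields a rational function that expands to it.\<close>

lemma expands_to_divide:
  assumes "expands_to R (fps_of_poly p * f)" "p \<noteq> 0"
  shows "expands_to (R / to_fract p) f"
proof -
  obtain N D where *: "D \<noteq> 0" "R = Fraction_Field.Fract N D"
      "fps_of_poly D * (fps_of_poly p * f) = fps_of_poly N"
    using assms(1) unfolding expands_to_def by metis
  then show ?thesis
    using assms(2) unfolding expands_to_def
    by (intro exI[of _ N] exI[of _ "D * p"])
      (simp add: fps_of_poly_mult mult.assoc Fract_conv_to_fract)
qed

text \<open>Removing the term for \<open>G\<close> itself from the hypothesis expresses \<open>V G\<close> through proper subsets as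
  \<open>(T\<^sup>n A' - A) / (1 - c T\<^sup>n)\<close>, and inversion exchanges \<open>A\<close> with \<open>A'\<close>.\<close>

lemma self_dual_expansion:
  fixes V :: "'a set \<Rightarrow> rat poly fract fps" and r :: "'a set \<Rightarrow> int"
  assumes rec: "\<And>G. finite G \<Longrightarrow> (\<Sum>U\<in>Pow G. V U)
      = fps_X ^ card G * (\<Sum>U\<in>Pow G. fps_const (var_q powi (- r U)) * V U)"
    and empty: "V {} = 1" "r {} = 0" and "finite G"
  shows "\<exists>R. expands_to R (V G) \<and> invert_qT R = const_T (var_q powi (- r G)) * R"
  using \<open>finite G\<close>
proof (induction G rule: finite_psubset_induct)
  case (psubset G)
  note inv = inj_ring_hom_invert_qT and const = inj_ring_hom_const_T
  show ?case
  proof (cases "G = {}")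
    case True
    \<comment> \<open>For the empty set \<open>rec\<close> is a tautology, so the value has to come
      from \<open>empty\<close>.\<close>
    have "expands_to 1 (V G)" using expands_to_fps_of_poly[of 1] True empty by simp
    then show ?thesis
      using True empty by (intro exI[of _ 1]) (simp add: inj_ring_hom.hom_one inv const)
  next
    case False
    obtain R where R: "expands_to (R U) (V U)" "invert_qT (R U) = const_T (var_q powi (- r U)) * R U"
      if "U \<subset> G" for U
      using psubset.IH by metis
    define n where "n = card G"
    define c where "c = var_q powi (- r G)"
    define A where "A = (\<Sum>U\<in>Pow G - {G}. R U)"
    define A' where "A' = (\<Sum>U\<in>Pow G - {G}. const_T (var_q powi (- r U)) * R U)"
    define D where "D = 1 - monom c n"
    define t where "t = var_T ^ n"
    define R0 where "R0 = (t * A' - A) / to_fract D"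
    \<comment> \<open>A positive exponent keeps the constant coefficient of \<open>D\<close> equal
      to 1, whatever \<open>c\<close> is.\<close>
    have "n \<noteq> 0" using False psubset.hyps by (simp add: n_def)
    then have "coeff D 0 = 1" by (simp add: D_def)
    then have D: "D \<noteq> 0" by auto
    have fin: "finite (Pow G)" using psubset.hyps by simp
    have "V G + (\<Sum>U\<in>Pow G - {G}. V U) = fps_X ^ n * (fps_const c * V G
        + (\<Sum>U\<in>Pow G - {G}. fps_const (var_q powi (- r U)) * V U))"
      using rec[OF psubset.hyps] sum.remove[OF fin, of G V]
        sum.remove[OF fin, of G "\<lambda>U. fps_const (var_q powi (- r U)) * V U"]
      by (simp add: n_def c_def)
    then have V: "fps_of_poly D * V G
        = fps_X ^ n * (\<Sum>U\<in>Pow G - {G}. fps_const (var_q powi (- r U)) * V U)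
          - (\<Sum>U\<in>Pow G - {G}. V U)"
      by (simp add: D_def fps_of_poly_diff fps_of_poly_monom algebra_simps)
    have A: "expands_to A (\<Sum>U\<in>Pow G - {G}. V U)"
      unfolding A_def by (intro expands_to_sum R) auto
    have A': "expands_to A' (\<Sum>U\<in>Pow G - {G}. fps_const (var_q powi (- r U)) * V U)"
      unfolding A'_def by (intro expands_to_sum expands_to_mult expands_to_const R) auto
    have "expands_to (t * A' - A) (fps_of_poly D * V G)"
      unfolding V t_def by (intro expands_to_diff expands_to_mult expands_to_X_power A A')
    then have exp: "expands_to R0 (V G)" unfolding R0_def using D by (rule expands_to_divide)
    have inv_const: "invert_qT (const_T (var_q powi k)) = const_T (var_q powi (- k))" for k
      by (simp add: invert_qT_const_T invert_q_powi)
    have cancel: "const_T (var_q powi (- k)) * const_T (var_q powi k) = 1" for k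
      by (simp add: var_q_nonzero inj_ring_hom.hom_one const
          flip: inj_ring_hom.hom_mult[OF const] power_int_add)
    \<comment> \<open>By induction, inversion multiplies each \<open>R U\<close> by the very
      coefficient that it carries in \<open>A'\<close>.\<close>
    have inv_A: "invert_qT A = A'"
      unfolding A_def A'_def inj_ring_hom.hom_sum[OF inv] by (intro sum.cong R) auto
    \<comment> \<open>Here the coefficient of \<open>R U\<close> is itself inverted and cancels the
      factor that \<open>R U\<close> acquires.\<close>
    have inv_A': "invert_qT A' = A"
      unfolding A_def A'_def inj_ring_hom.hom_sum[OF inv]
    proof (rule sum.cong[OF refl])
      fix U assume "U \<in> Pow G - {G}"
      then have "invert_qT (const_T (var_q powi (- r U)) * R U)
          = const_T (var_q powi (- (- r U))) * (const_T (var_q powi (- r U)) * R U)"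
        using R(2)[of U] by (simp only: inj_ring_hom.hom_mult[OF inv] inv_const) auto
      also have "\<dots> = R U" using cancel[of "- r U"] by (simp flip: mult.assoc)
      finally show "invert_qT (const_T (var_q powi (- r U)) * R U) = R U" .
    qed
    define x where "x = const_T c"
    have x: "x \<noteq> 0" "invert_qT x = inverse x"
      using cancel[of "r G"] inv_const[of "- r G"]
      by (auto simp: x_def c_def intro: inverse_unique[symmetric])
    have t: "t \<noteq> 0" "invert_qT t = inverse t"
      by (simp_all add: t_def var_T_nonzero inj_ring_hom.hom_power[OF inv] invert_qT_var_T power_inverse)
    have Dx: "to_fract D = 1 - x * t" by (simp add: D_def to_fract_monom x_def t_def)
    then have nz: "1 - x * t \<noteq> 0" using D by (metis to_fract_eq_0_iff)
    have "invert_qT R0 = (inverse t * A - A') / (1 - inverse x * inverse t)"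
      unfolding R0_def Dx
      by (simp add: inj_ring_hom_divide[OF inv] inj_ring_hom.hom_diff[OF inv]
          inj_ring_hom.hom_mult[OF inv] inj_ring_hom.hom_one[OF inv] inv_A inv_A' x t)
    \<comment> \<open>Multiplying numerator and denominator by \<open>x * t\<close> gives
      \<open>x * (A - t * A') / (x * t - 1)\<close>, which is \<open>x * R0\<close>.\<close>
    also have "1 - inverse x * inverse t = - (1 - x * t) / (x * t)"
      using x t by (simp add: field_simps)
    also have "(inverse t * A - A') / (- (1 - x * t) / (x * t)) = x * R0"
      unfolding R0_def Dx using x t nz by (simp add: divide_simps) (simp add: algebra_simps)
    finally show ?thesis using exp unfolding x_def c_def by blast
  qed
qed

subsection \<open>Initial matroids and characteristic polynomials\<close>

lemma card_inter_le_rk: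
  assumes "finite \<A>" "B \<in> \<A>"
  shows "card (B \<inter> S) \<le> rk \<A> S"
  using assms by (simp add: rk_def)

lemma rk_attained:
  assumes "finite \<A>" "\<A> \<noteq> {}"
  obtains B where "B \<in> \<A>" "card (B \<inter> S) = rk \<A> S"
proof -
  have "rk \<A> S \<in> (\<lambda>B. card (B \<inter> S)) ` \<A>"
    unfolding rk_def using assms by (intro Max_in) auto
  then show ?thesis using that by force
qed

context matroid
begin

text \<open>The subfamily \<open>\<A>\<close> lets this serve both \<open>\<B>\<close> and the
  initial bases.\<close>

lemma rk_mono:
  assumes "\<A> \<subseteq> \<B>" "\<A> \<noteq> {}" "S \<subseteq> S'"
  shows "rk \<A> S \<le> rk \<A> S'"
proof -
  have fin: "finite \<A>" using assms finite_bases finite_subset by blast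
  obtain B where B: "B \<in> \<A>" "card (B \<inter> S) = rk \<A> S" using rk_attained[OF fin assms(2)] .
  have "card (B \<inter> S) \<le> card (B \<inter> S')"
    using B assms finite_basis by (intro card_mono) auto
  then show ?thesis using B card_inter_le_rk[OF fin B(1), of S'] by simp
qed

text \<open>The augmentation property for the independent set \<open>B \<inter> F\<close> inside
  \<open>F\<close>, derived from basis exchange by comparing \<open>B\<close> with a well-chosen
  larger competitor.\<close>

lemma exchange_into:
  assumes B: "B \<in> \<B>" and less: "card (B \<inter> F) < rk \<B> F"
  shows "\<exists>B'\<in>\<B>. B \<inter> F \<subset> B' \<inter> F"
proof -
  obtain C0 where C0: "C0 \<in> \<B>" "card (C0 \<inter> F) = rk \<B> F"
    using rk_attained[OF finite_bases bases_nonempty] .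
  define P where "P C \<longleftrightarrow> C \<in> \<B> \<and> card (B \<inter> F) < card (C \<inter> F)" for C
  have "P C0" using C0 less by (simp add: P_def)
  \<comment> \<open>Among the bases that meet \<open>F\<close> in more elements than
    \<open>B\<close> does, take one with as little as possible outside both \<open>F\<close> and
    \<open>B\<close>.\<close>
  then obtain C where C: "P C" and least: "\<And>C'. P C' \<Longrightarrow> card (C - F - B) \<le> card (C' - F - B)"
    using ex_has_least_nat[of P C0 "\<lambda>C. card (C - F - B)"] by blast
  have CB: "C \<in> \<B>" and cardC: "card (B \<inter> F) < card (C \<inter> F)" using C by (auto simp: P_def)
  have fin: "finite B" "finite C" using B CB finite_basis by auto
  have sub: "C - F \<subseteq> B"
  proof (rule ccontr)
    assume "\<not> C - F \<subseteq> B"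
    then obtain x where x: "x \<in> C" "x \<notin> F" "x \<notin> B" by blast
    then obtain y where y: "y \<in> B - C" "insert y (C - {x}) \<in> \<B>"
      using basis_exchange[OF CB B, of x] by blast
    \<comment> \<open>Trading \<open>x\<close> for an element of \<open>B\<close> loses nothing
      inside \<open>F\<close> but shrinks the part outside \<open>F\<close> and \<open>B\<close>,
      against minimality.\<close>
    have "card (C \<inter> F) \<le> card (insert y (C - {x}) \<inter> F)"
      using x fin by (intro card_mono) auto
    then have "P (insert y (C - {x}))" using y cardC by (simp add: P_def)
    moreover have "insert y (C - {x}) - F - B = (C - F - B) - {x}" using x y by auto
    then have "card (insert y (C - {x}) - F - B) < card (C - F - B)"
      using x fin card_Diff1_less[of "C - F - B" x] by simp
    ultimately show False using least[of "insert y (C - {x})"] by simp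
  qed
  \<comment> \<open>Otherwise \<open>B\<close> and \<open>C\<close> would agree outside
    \<open>F\<close>, and \<open>C\<close> would be the larger basis.\<close>
  have "\<not> B - F \<subseteq> C"
  proof
    assume "B - F \<subseteq> C"
    then have "B - F = C - F" using sub by auto
    moreover have "card B = card (B - F) + card (B \<inter> F)" "card C = card (C - F) + card (C \<inter> F)"
      using fin by (metis add.commute card_Int_Diff)+
    moreover have "card B = card C" using card_basis B CB by simp
    ultimately show False using cardC by simp
  qed
  then obtain x where x: "x \<in> B" "x \<notin> F" "x \<notin> C" by blast
  then obtain y where y: "y \<in> C - B" "insert y (B - {x}) \<in> \<B>"
    using basis_exchange[OF B CB, of x] by blast
  \<comment> \<open>Everything in \<open>C\<close> outside \<open>F\<close> already belongs to
    \<open>B\<close>, so the new element must lie in \<open>F\<close>.\<close>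
  then have "y \<in> F" using sub by auto
  then have "B \<inter> F \<subset> insert y (B - {x}) \<inter> F" using x y by auto
  then show ?thesis using y by blast
qed

text \<open>Iterates \<open>exchange_into\<close>, with induction on the rank still missing in
  \<open>F\<close>.\<close>

lemma extend_inter:
  assumes "B \<in> \<B>"
  obtains B' where "B' \<in> \<B>" "B \<inter> F \<subseteq> B'" "card (B' \<inter> F) = rk \<B> F"
proof -
  have "\<exists>B'\<in>\<B>. B \<inter> F \<subseteq> B' \<and> card (B' \<inter> F) = rk \<B> F"
    using assms
  proof (induction "rk \<B> F - card (B \<inter> F)" arbitrary: B rule: less_induct)
    case less
    show ?case
    proof (cases "card (B \<inter> F) < rk \<B> F")
      case True
      then obtain B' where B': "B' \<in> \<B>" "B \<inter> F \<subset> B' \<inter> F"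
        using exchange_into[OF less.prems True] by blast
      then have "card (B \<inter> F) < card (B' \<inter> F)"
        using finite_basis by (simp add: psubset_card_mono)
      then have "rk \<B> F - card (B' \<inter> F) < rk \<B> F - card (B \<inter> F)" using True by simp
      from less.hyps[OF this B'(1)] show ?thesis using B' by blast
    next
      case False
      then have "card (B \<inter> F) = rk \<B> F"
        using card_inter_le_rk[OF finite_bases less.prems, of F] by simp
      then show ?thesis using less.prems by blast
    qed
  qed
  then show ?thesis using that by blast
qed

section \<open>Bases of maximal weight\<close>

lemma sum_basis_le_wt:
  assumes "B \<in> \<B>"
  shows "(\<Sum>e\<in>B. w e) \<le> wt \<B> w"
  using assms finite_bases by (simp add: wt_def)

lemma initial_bases_subset: "initial_bases \<B> w \<subseteq> \<B>"
  by (auto simp: initial_bases_def)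

lemma finite_initial_bases: "finite (initial_bases \<B> w)"
  using initial_bases_subset finite_bases finite_subset by blast

lemma initial_bases_nonempty: "initial_bases \<B> w \<noteq> {}"
proof -
  have "wt \<B> w \<in> (\<lambda>B. \<Sum>e\<in>B. w e) ` \<B>"
    unfolding wt_def using finite_bases bases_nonempty by (intro Max_in) auto
  then show ?thesis by (auto simp: initial_bases_def)
qed

text \<open>Bases lie in \<open>E\<close>. This mediates between lattice points, which are
  \<open>undefined\<close> off \<open>E\<close>, and weights that vanish there.\<close>

lemma initial_bases_cong:
  assumes "\<And>e. e \<in> E \<Longrightarrow> w e = w' e"
  shows "wt \<B> w = wt \<B> w'" "initial_bases \<B> w = initial_bases \<B> w'"
proof -
  have eq: "(\<Sum>e\<in>B. w e) = (\<Sum>e\<in>B. w' e)" if "B \<in> \<B>" for B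
    using that bases_subset assms by (intro sum.cong) auto
  then show "wt \<B> w = wt \<B> w'" by (simp add: wt_def cong: image_cong)
  then show "initial_bases \<B> w = initial_bases \<B> w'" using eq by (auto simp: initial_bases_def)
qed

section \<open>Adding the indicator of \<open>H\<close> to a nonnegative weight supported in
  \<open>H\<close>\<close>

context
  fixes H :: "'a set" and w w' :: "'a \<Rightarrow> int"
  assumes nonneg: "\<And>e. 0 \<le> w' e" and outside: "\<And>e. e \<notin> H \<Longrightarrow> w' e = 0"
    and w_eq: "\<And>e. w e = w' e + of_bool (e \<in> H)"
begin

lemma sum_basis_step:
  assumes "B \<in> \<B>"
  shows "(\<Sum>e\<in>B. w e) = (\<Sum>e\<in>B. w' e) + int (card (B \<inter> H))"
proof -
  have "(\<Sum>e\<in>B. w e) = (\<Sum>e\<in>B. w' e) + (\<Sum>e\<in>B. of_bool (e \<in> H))"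
    by (simp only: w_eq sum.distrib)
  then show ?thesis using finite_basis[OF assms] by simp
qed

text \<open>All the weight of \<open>B\<close> sits on \<open>B \<inter> H\<close>, which
  \<open>B'\<close> contains, so \<open>B'\<close> weighs at least as much.\<close>

lemma extend_initial:
  assumes "B \<in> initial_bases \<B> w'" "B' \<in> \<B>" "B \<inter> H \<subseteq> B'"
  shows "B' \<in> initial_bases \<B> w'"
proof -
  have fin: "finite B" "finite B'" using assms finite_basis by (auto simp: initial_bases_def)
  have "(\<Sum>e\<in>B. w' e) = (\<Sum>e\<in>B \<inter> H. w' e)"
    using fin outside by (intro sum.mono_neutral_right) auto
  also have "\<dots> \<le> (\<Sum>e\<in>B'. w' e)"
    using fin assms nonneg by (intro sum_mono2) auto
  finally show ?thesis
    using assms sum_basis_le_wt[OF assms(2), of w'] by (auto simp: initial_bases_def)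
qed

text \<open>The weight of a basis is a sum of two quantities with maxima \<open>wt \<B> w'\<close>
  and \<open>rk \<B> H\<close>. Extending a \<open>w'\<close>-initial basis inside \<open>H\<close>
  attains both at once.\<close>

lemma wt_step: "wt \<B> w = wt \<B> w' + int (rk \<B> H)"
proof (rule antisym)
  obtain B where B: "B \<in> initial_bases \<B> w" using initial_bases_nonempty by blast
  then have "B \<in> \<B>" "wt \<B> w = (\<Sum>e\<in>B. w' e) + int (card (B \<inter> H))"
    using sum_basis_step by (auto simp: initial_bases_def)
  then show "wt \<B> w \<le> wt \<B> w' + int (rk \<B> H)"
    using sum_basis_le_wt[of B w'] card_inter_le_rk[OF finite_bases, of B H] by linarith
next
  obtain B where B: "B \<in> initial_bases \<B> w'" using initial_bases_nonempty by blast
  then have "B \<in> \<B>" by (simp add: initial_bases_def)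
  then obtain B' where B': "B' \<in> \<B>" "B \<inter> H \<subseteq> B'" "card (B' \<inter> H) = rk \<B> H"
    using extend_inter by blast
  then have "(\<Sum>e\<in>B'. w' e) = wt \<B> w'"
    using extend_initial[OF B] by (simp add: initial_bases_def)
  then show "wt \<B> w' + int (rk \<B> H) \<le> wt \<B> w"
    using sum_basis_le_wt[OF B'(1), of w] sum_basis_step[OF B'(1)] B'(3) by simp
qed

text \<open>As both maxima are attained together, a basis maximises the sum exactly when it
  maximises each summand.\<close>

lemma initial_bases_step:
  "initial_bases \<B> w = {B \<in> initial_bases \<B> w'. card (B \<inter> H) = rk \<B> H}"
proof (rule Set.set_eqI, rule iffI)
  fix B assume "B \<in> initial_bases \<B> w"
  then have "B \<in> \<B>" "(\<Sum>e\<in>B. w e) = wt \<B> w" by (simp_all add: initial_bases_def)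
  then have "B \<in> \<B>" "(\<Sum>e\<in>B. w' e) + int (card (B \<inter> H)) = wt \<B> w' + int (rk \<B> H)"
    using sum_basis_step[of B] wt_step by simp_all
  then show "B \<in> {B \<in> initial_bases \<B> w'. card (B \<inter> H) = rk \<B> H}"
    using sum_basis_le_wt[of B w'] card_inter_le_rk[OF finite_bases, of B H]
    by (auto simp: initial_bases_def)
next
  fix B assume "B \<in> {B \<in> initial_bases \<B> w'. card (B \<inter> H) = rk \<B> H}"
  then show "B \<in> initial_bases \<B> w"
    using sum_basis_step[of B] wt_step by (auto simp: initial_bases_def)
qed

text \<open>In terms of ranks, the initial matroid of \<open>w\<close> is the direct sum of the
  contraction by \<open>H\<close> and the restriction to \<open>H\<close> of the initial matroid of
  \<open>w'\<close>. For a single basis the identity is modularity of cardinality; one inequality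
  bounds each term, the other needs a basis optimal for all terms.\<close>

lemma rk_initial_bases_step:
  "rk (initial_bases \<B> w) S + rk \<B> H = rk \<B> (H \<union> S) + rk (initial_bases \<B> w') (S \<inter> H)"
proof (rule antisym)
  have split: "card (B \<inter> (H \<union> S)) + card (B \<inter> (S \<inter> H)) = card (B \<inter> S) + card (B \<inter> H)"
    if "B \<in> \<B>" for B
  proof -
    have "B \<inter> (H \<union> S) = (B \<inter> S) \<union> (B \<inter> H)" "B \<inter> (S \<inter> H) = (B \<inter> S) \<inter> (B \<inter> H)"
      by auto
    then show ?thesis
      using card_Un_Int[of "B \<inter> S" "B \<inter> H"] finite_basis[OF that] by simp
  qed
  {
    obtain B where B: "B \<in> initial_bases \<B> w" "card (B \<inter> S) = rk (initial_bases \<B> w) S"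
      using rk_attained[OF finite_initial_bases initial_bases_nonempty] .
    then have "B \<in> \<B>" "B \<in> initial_bases \<B> w'" "card (B \<inter> H) = rk \<B> H"
      using initial_bases_step initial_bases_subset by auto
    then show "rk (initial_bases \<B> w) S + rk \<B> H
        \<le> rk \<B> (H \<union> S) + rk (initial_bases \<B> w') (S \<inter> H)"
      using split[of B] B(2) card_inter_le_rk[OF finite_bases, of B "H \<union> S"]
        card_inter_le_rk[OF finite_initial_bases, of B w' "S \<inter> H"] by linarith
  }
  obtain B where B: "B \<in> initial_bases \<B> w'"
      "card (B \<inter> (S \<inter> H)) = rk (initial_bases \<B> w') (S \<inter> H)"
    using rk_attained[OF finite_initial_bases initial_bases_nonempty] .
  have "B \<in> \<B>" using B initial_bases_subset by blast
  \<comment> \<open>Extend first within \<open>H\<close>, then within \<open>H \<union> S\<close>.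
    Both extensions keep \<open>B \<inter> H\<close>, so the result stays initial for
    \<open>w'\<close>.\<close>
  then obtain B1 where B1: "B1 \<in> \<B>" "B \<inter> H \<subseteq> B1" "card (B1 \<inter> H) = rk \<B> H"
    using extend_inter by blast
  then obtain B2 where B2: "B2 \<in> \<B>" "B1 \<inter> (H \<union> S) \<subseteq> B2"
      "card (B2 \<inter> (H \<union> S)) = rk \<B> (H \<union> S)"
    using extend_inter by blast
  have B2': "B2 \<in> initial_bases \<B> w'"
    using extend_initial[OF B(1)] B1 B2 by blast
  have "card (B1 \<inter> H) \<le> card (B2 \<inter> H)"
    using B2 finite_basis by (intro card_mono) auto
  then have cH: "card (B2 \<inter> H) = rk \<B> H"
    using B1 card_inter_le_rk[OF finite_bases B2(1), of H] by simp
  then have "B2 \<in> initial_bases \<B> w" using initial_bases_step B2' by blast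
  then have "card (B2 \<inter> S) \<le> rk (initial_bases \<B> w) S"
    by (rule card_inter_le_rk[OF finite_initial_bases])
  moreover have "card (B \<inter> (S \<inter> H)) \<le> card (B2 \<inter> (S \<inter> H))"
    using B1 B2 finite_basis by (intro card_mono) auto
  ultimately show "rk \<B> (H \<union> S) + rk (initial_bases \<B> w') (S \<inter> H)
      \<le> rk (initial_bases \<B> w) S + rk \<B> H"
    using split[OF B2(1)] B2(3) B(2) cH by linarith
qed

text \<open>Characteristic polynomials are multiplicative on direct sums; the first factor belongs
  to the contraction by \<open>H\<close>.\<close>

lemma char_poly_step:
  assumes "finite G" "H \<subseteq> G"
  shows "matroid_char_poly G (initial_bases \<B> w)
    = (\<Sum>U | U \<in> Pow G \<and> H \<subseteq> U. monom ((-1) ^ card (U - H)) (rk \<B> G - rk \<B> U))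
      * matroid_char_poly H (initial_bases \<B> w')"
proof -
  have fin: "finite S" if "S \<subseteq> G" for S using that assms finite_subset by blast
  have "monom ((-1) ^ card S) (rk (initial_bases \<B> w) G - rk (initial_bases \<B> w) S)
      = monom ((-1) ^ card (H \<union> S - H)) (rk \<B> G - rk \<B> (H \<union> S))
       * monom ((-1 :: rat) ^ card (S \<inter> H)) (rk (initial_bases \<B> w') H - rk (initial_bases \<B> w') (S \<inter> H))"
    if "S \<in> Pow G" for S
  proof -
    have "card S = card (H \<union> S - H) + card (S \<inter> H)"
      using fin that card_Int_Diff[of S H] by (simp add: Un_Diff)
    moreover have "rk (initial_bases \<B> w) S + rk \<B> H = rk \<B> (H \<union> S) + rk (initial_bases \<B> w') (S \<inter> H)"
      "rk (initial_bases \<B> w) G + rk \<B> H = rk \<B> G + rk (initial_bases \<B> w') H"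
      using rk_initial_bases_step[of S] rk_initial_bases_step[of G] assms(2)
      by (simp_all add: Un_absorb1 Int_absorb1)
    moreover have "rk \<B> (H \<union> S) \<le> rk \<B> G"
      using that assms by (intro rk_mono bases_nonempty) auto
    moreover have "rk (initial_bases \<B> w') (S \<inter> H) \<le> rk (initial_bases \<B> w') H"
      by (intro rk_mono initial_bases_nonempty initial_bases_subset) auto
    \<comment> \<open>Monotonicity makes the truncated differences exact, so the exponents
      add.\<close>
    ultimately have e: "rk (initial_bases \<B> w) G - rk (initial_bases \<B> w) S
       = (rk \<B> G - rk \<B> (H \<union> S)) + (rk (initial_bases \<B> w') H - rk (initial_bases \<B> w') (S \<inter> H))"
      and c: "card S = card (H \<union> S - H) + card (S \<inter> H)"
      by linarith+
    show ?thesis unfolding e c by (simp add: mult_monom power_add)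
  qed
  then have "matroid_char_poly G (initial_bases \<B> w)
      = (\<Sum>S\<in>Pow G. monom ((-1) ^ card (H \<union> S - H)) (rk \<B> G - rk \<B> (H \<union> S))
       * monom ((-1) ^ card (S \<inter> H)) (rk (initial_bases \<B> w') H - rk (initial_bases \<B> w') (S \<inter> H)))"
    unfolding matroid_char_poly_def by (rule sum.cong[OF refl])
  \<comment> \<open>A subset \<open>S\<close> of \<open>G\<close> is encoded by
    \<open>H \<union> S\<close> and \<open>S \<inter> H\<close>.\<close>
  also have "\<dots> = (\<Sum>(U, S)\<in>{U. U \<in> Pow G \<and> H \<subseteq> U} \<times> Pow H.
       monom ((-1) ^ card (U - H)) (rk \<B> G - rk \<B> U)
       * monom ((-1) ^ card S) (rk (initial_bases \<B> w') H - rk (initial_bases \<B> w') S))"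
    by (rule sum.reindex_bij_witness[of _ "\<lambda>(U, S). (U - H) \<union> S" "\<lambda>S. (H \<union> S, S \<inter> H)"])
      (use assms(2) in auto)
  finally show ?thesis
    by (simp add: sum_product sum.cartesian_product matroid_char_poly_def)
qed

end

end

subsection \<open>The zeta function as a series\<close>

text \<open>Total functions vanishing off \<open>G\<close>, so that the same function can be read
  over \<open>G\<close> or over its support.\<close>

definition weights :: "'a set \<Rightarrow> nat \<Rightarrow> ('a \<Rightarrow> int) set" where
  "weights G n = {w. (\<forall>e. 0 \<le> w e) \<and> (\<forall>e. e \<notin> G \<longrightarrow> w e = 0) \<and> (\<Sum>e\<in>G. w e) = int n}"

definition support :: "('a \<Rightarrow> int) \<Rightarrow> 'a set" where
  "support w = {e. w e \<noteq> 0}"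

text \<open>The characteristic polynomial of the contraction by \<open>H\<close> of the restriction
  to \<open>G\<close>, each subset of \<open>G - H\<close> being replaced by its union
  \<open>U\<close> with \<open>H\<close>.\<close>

definition relative_char :: "'a set set \<Rightarrow> 'a set \<Rightarrow> 'a set \<Rightarrow> rat poly fract" where
  "relative_char \<B> H G = to_fract
     (\<Sum>U | U \<in> Pow G \<and> H \<subseteq> U. monom ((-1) ^ card (U - H)) (rk \<B> G - rk \<B> U))"

text \<open>Since \<open>rk\<close> intersects bases with its argument, the ground set
  \<open>G\<close> stands for restriction to \<open>G\<close> while \<open>\<B>\<close> stays
  fixed.\<close>

definition weight_term :: "'a set set \<Rightarrow> 'a set \<Rightarrow> ('a \<Rightarrow> int) \<Rightarrow> rat poly fract" where
  "weight_term \<B> G w = to_fract (matroid_char_poly G (initial_bases \<B> w)) * var_q powi (- wt \<B> w)"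

definition weight_series :: "'a set set \<Rightarrow> 'a set \<Rightarrow> rat poly fract fps" where
  "weight_series \<B> G = Abs_fps (\<lambda>n. \<Sum>w\<in>weights G n. weight_term \<B> G w)"

text \<open>The sum over weights with support exactly \<open>G\<close>, after subtracting the
  indicator of \<open>G\<close>: this costs \<open>card G\<close> in degree and
  \<open>rk \<B> G\<close> in weight.\<close>

definition full_support_series :: "'a set set \<Rightarrow> 'a set \<Rightarrow> rat poly fract fps" where
  "full_support_series \<B> G
     = fps_const (var_q powi (- int (rk \<B> G))) * (fps_X ^ card G * weight_series \<B> G)"

text \<open>The sign is split between \<open>G\<close> and \<open>H\<close> to fit the symmetric
  form of inclusion-exclusion.\<close>

definition alternating_series :: "'a set set \<Rightarrow> 'a set \<Rightarrow> rat poly fract fps" where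
  "alternating_series \<B> G
     = (-1) ^ card G * (\<Sum>H\<in>Pow G. (-1) ^ card H * full_support_series \<B> H)"

lemma finite_weights:
  assumes "finite G"
  shows "finite (weights G n)"
proof (rule finite_subset)
  show "finite {w. \<forall>e. (e \<in> G \<longrightarrow> w e \<in> {0..int n}) \<and> (e \<notin> G \<longrightarrow> w e = 0)}"
    using assms by (intro finite_set_of_finite_funs) auto
  show "weights G n \<subseteq> {w. \<forall>e. (e \<in> G \<longrightarrow> w e \<in> {0..int n}) \<and> (e \<notin> G \<longrightarrow> w e = 0)}"
  proof clarify
    fix w e assume w: "w \<in> weights G n"
    have "w e \<le> (\<Sum>e\<in>G. w e)" if "e \<in> G"
      using w that assms by (intro member_le_sum) (auto simp: weights_def)
    then show "(e \<in> G \<longrightarrow> w e \<in> {0..int n}) \<and> (e \<notin> G \<longrightarrow> w e = 0)"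
      using w by (auto simp: weights_def)
  qed
qed

lemma minus_one_power_card_Diff:
  assumes "finite U" "H \<subseteq> U"
  shows "(-1 :: 'b::ring_1) ^ card (U - H) = (-1) ^ card U * (-1) ^ card H"
proof -
  have "card U = card (U - H) + card H"
    using assms by (metis card_mono card_Diff_subset finite_subset le_add_diff_inverse2)
  then show ?thesis by (cases "even (card H)") (simp_all add: power_add)
qed

lemma var_q_minus_one: "var_q - 1 = to_fract [:-1, 1:]" "var_q \<noteq> 1"
proof -
  have "[:-1, 1:] = [:0, 1:] - (1 :: rat poly)" by (simp add: one_pCons)
  then show eq: "var_q - 1 = to_fract [:-1, 1:]" by (simp only: var_q_def to_fract_diff to_fract_1)
  then show "var_q \<noteq> 1" by auto
qed

lemma to_fract_monom_minus_one:
  "to_fract (monom ((-1) ^ j) k) = (-1) ^ j * var_q ^ k"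
proof -
  have "monom ((-1 :: rat) ^ j) k = (-1) ^ j * [:0, 1:] ^ k"
    by (cases "even j") (simp_all add: monom_altdef)
  then show ?thesis
    by (simp add: var_q_def inj_ring_hom.hom_power[OF inj_ring_hom_to_fract])
qed

context matroid
begin

text \<open>Subtracting the indicator of \<open>H\<close> is a bijection onto
  \<open>weights H (n - card H)\<close>. \<open>char_poly_step\<close> supplies the factor
  \<open>relative_char\<close> and \<open>wt_step\<close> the power of \<open>q\<close>.\<close>

lemma sum_support_weight_term:
  assumes "finite G" "H \<subseteq> G"
  shows "(\<Sum>w | w \<in> weights G n \<and> support w = H. weight_term \<B> G w)
    = relative_char \<B> H G * full_support_series \<B> H $ n"
proof -
  have finH: "finite H" using assms finite_subset by blast
  have sum_ind: "(\<Sum>e\<in>H. of_bool (e \<in> H)) = int (card H)" using finH by simp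
  show ?thesis
  proof (cases "card H \<le> n")
    case False
    \<comment> \<open>Each point of the support contributes at least 1, so for
      \<open>n < card H\<close> the sum is empty; on the right the factor
      \<open>fps_X ^ card H\<close> kills the coefficient.\<close>
    have "\<not> (w \<in> weights G n \<and> support w = H)" for w
    proof
      assume w: "w \<in> weights G n \<and> support w = H"
      have "(\<Sum>e\<in>H. of_bool (e \<in> H)) \<le> (\<Sum>e\<in>H. w e)"
      proof (rule sum_mono)
        fix e assume "e \<in> H"
        moreover from this have "w e \<noteq> 0" "0 \<le> w e"
          using w by (auto simp: weights_def support_def)
        ultimately show "of_bool (e \<in> H) \<le> w e" by simp
      qed
      also have "\<dots> \<le> (\<Sum>e\<in>G. w e)"
        using w assms by (intro sum_mono2) (auto simp: weights_def)
      finally show False using w False sum_ind by (auto simp: weights_def)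
    qed
    then have "{w. w \<in> weights G n \<and> support w = H} = {}" by blast
    then show ?thesis using False
      by (simp only: sum.empty) (simp add: full_support_series_def fps_X_power_mult_nth)
  next
    case True
    have "(\<Sum>w | w \<in> weights G n \<and> support w = H. weight_term \<B> G w)
      = (\<Sum>w'\<in>weights H (n - card H).
          relative_char \<B> H G * (var_q powi (- int (rk \<B> H)) * weight_term \<B> H w'))"
    proof (rule sum.reindex_bij_witness
        [of _ "\<lambda>w' e. w' e + of_bool (e \<in> H)" "\<lambda>w e. w e - of_bool (e \<in> H)"])
      fix w assume w: "w \<in> {w. w \<in> weights G n \<and> support w = H}"
      define w' where "w' = (\<lambda>e. w e - of_bool (e \<in> H))"
      show "(\<lambda>e. (w e - of_bool (e \<in> H)) + of_bool (e \<in> H)) = w" by simp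
      have nonneg: "0 \<le> w' e" for e
      proof (cases "e \<in> H")
        case True
        then have "w e \<noteq> 0" "0 \<le> w e" using w by (auto simp: weights_def support_def)
        then show ?thesis using True by (simp add: w'_def)
      qed (use w in \<open>simp add: w'_def weights_def\<close>)
      have out: "w' e = 0" if "e \<notin> H" for e using w that by (auto simp: w'_def support_def)
      have "(\<Sum>e\<in>G. w e) = (\<Sum>e\<in>H. w e)"
        using w assms by (intro sum.mono_neutral_right) (auto simp: support_def)
      then have "(\<Sum>e\<in>H. w' e) = int (n - card H)"
        using w True sum_ind by (simp add: w'_def sum_subtractf weights_def of_nat_diff)
      then show "(\<lambda>e. w e - of_bool (e \<in> H)) \<in> weights H (n - card H)"
        using nonneg out by (simp add: weights_def w'_def)
      have w_eq: "w e = w' e + of_bool (e \<in> H)" for e by (simp add: w'_def)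
      have "weight_term \<B> G w
          = relative_char \<B> H G * (var_q powi (- int (rk \<B> H)) * weight_term \<B> H w')"
        by (simp add: weight_term_def relative_char_def wt_step[OF nonneg out w_eq]
            char_poly_step[OF nonneg out w_eq assms] power_int_diff[OF disjI1[OF var_q_nonzero]]
            power_int_minus field_simps)
      then show "relative_char \<B> H G * (var_q powi (- int (rk \<B> H))
          * weight_term \<B> H (\<lambda>e. w e - of_bool (e \<in> H))) = weight_term \<B> G w"
        by (simp add: w'_def)
    next
      fix w' assume w': "w' \<in> weights H (n - card H)"
      show "(\<lambda>e. (w' e + of_bool (e \<in> H)) - of_bool (e \<in> H)) = w'" by simp
      define w where "w = (\<lambda>e. w' e + of_bool (e \<in> H))"
      have nonneg: "0 \<le> w e" for e using w' by (simp add: w_def weights_def)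
      have supp: "support w = H"
      proof (rule Set.set_eqI)
        fix e
        have "0 \<le> w' e" "e \<notin> H \<Longrightarrow> w' e = 0" using w' by (auto simp: weights_def)
        then show "e \<in> support w \<longleftrightarrow> e \<in> H" by (cases "e \<in> H") (auto simp: support_def w_def)
      qed
      have "(\<Sum>e\<in>G. w e) = (\<Sum>e\<in>H. w e)"
        using supp assms by (intro sum.mono_neutral_right) (auto simp: support_def)
      also have "\<dots> = int n"
        using w' True sum_ind by (simp add: w_def sum.distrib weights_def of_nat_diff)
      finally have "w \<in> weights G n"
        using nonneg supp assms by (auto simp: weights_def support_def)
      then show "(\<lambda>e. w' e + of_bool (e \<in> H)) \<in> {w. w \<in> weights G n \<and> support w = H}"
        using supp by (simp add: w_def)
    qed
    then show ?thesis using True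
      by (simp add: full_support_series_def fps_X_power_mult_nth weight_series_def sum_distrib_left)
  qed
qed

section \<open>Decomposition by support and Moebius inversion\<close>

lemma support_weights:
  assumes "w \<in> weights G n"
  shows "support w \<subseteq> G"
  using assms by (auto simp: weights_def support_def)

text \<open>With integer exponents the factor from \<open>G\<close> separates, and \<open>H\<close>
  enters a summand only through its sign, as in \<open>alternating_series\<close>.\<close>

lemma relative_char_eq:
  assumes "finite G" "H \<subseteq> G"
  shows "relative_char \<B> H G = (\<Sum>U | U \<in> Pow G \<and> H \<subseteq> U.
      (-1) ^ card U * (-1) ^ card H * var_q powi int (rk \<B> G) * var_q powi (- int (rk \<B> U)))"
  unfolding relative_char_def to_fract_sum
proof (rule sum.cong[OF refl])
  fix U assume U: "U \<in> {U. U \<in> Pow G \<and> H \<subseteq> U}"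
  then have "rk \<B> U \<le> rk \<B> G" by (intro rk_mono bases_nonempty) auto
  then have "var_q ^ (rk \<B> G - rk \<B> U) = var_q powi (int (rk \<B> G) + (- int (rk \<B> U)))"
    by (simp add: power_int_def nat_diff_distrib)
  also have "\<dots> = var_q powi int (rk \<B> G) * var_q powi (- int (rk \<B> U))"
    by (rule power_int_add) (simp add: var_q_nonzero)
  finally show "to_fract (monom ((-1) ^ card (U - H)) (rk \<B> G - rk \<B> U))
     = (-1) ^ card U * (-1) ^ card H * var_q powi int (rk \<B> G) * var_q powi (- int (rk \<B> U))"
    using U assms finite_subset[of U G] minus_one_power_card_Diff[of U H, where 'b = "rat poly fract"]
    by (simp add: to_fract_monom_minus_one mult.assoc)
qed

lemma weight_series_eq:
  assumes "finite G"
  shows "weight_series \<B> G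
    = (\<Sum>H\<in>Pow G. fps_const (relative_char \<B> H G) * full_support_series \<B> H)"
proof (rule fps_ext)
  fix n
  have "(\<Sum>w\<in>weights G n. weight_term \<B> G w)
      = (\<Sum>H\<in>Pow G. \<Sum>w | w \<in> weights G n \<and> support w = H. weight_term \<B> G w)"
    by (rule sum.group[symmetric]) (auto simp: assms finite_weights dest!: support_weights)
  also have "\<dots> = (\<Sum>H\<in>Pow G. relative_char \<B> H G * full_support_series \<B> H $ n)"
    using assms sum_support_weight_term by (intro sum.cong) auto
  finally show "weight_series \<B> G $ n
      = (\<Sum>H\<in>Pow G. fps_const (relative_char \<B> H G) * full_support_series \<B> H) $ n"
    by (simp add: weight_series_def fps_sum_nth)
qed

text \<open>Moebius inversion on the Boolean lattice.\<close>

lemma sum_alternating_series: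
  assumes "finite G"
  shows "(\<Sum>U\<in>Pow G. alternating_series \<B> U) = full_support_series \<B> G"
  unfolding alternating_series_def
  by (rule inclusion_exclusion_symmetric[OF refl assms, symmetric])

lemma weight_series_alternating:
  assumes "finite G"
  shows "weight_series \<B> G = fps_const (var_q powi int (rk \<B> G))
    * (\<Sum>U\<in>Pow G. fps_const (var_q powi (- int (rk \<B> U))) * alternating_series \<B> U)"
proof -
  define q where "q k = fps_const (var_q powi k)" for k
  have const: "fps_const (sum f I) = (\<Sum>i\<in>I. fps_const (f i))" for f :: "'a set \<Rightarrow> rat poly fract" and I
    by (rule fps_ext) (simp add: fps_sum_nth)
  have sgn: "fps_const ((-1 :: rat poly fract) ^ k) = (-1) ^ k" for k
    by (induction k) (simp_all flip: fps_const_neg fps_const_mult)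
  have "weight_series \<B> G = (\<Sum>H\<in>Pow G. \<Sum>U | U \<in> Pow G \<and> H \<subseteq> U.
      (-1) ^ card U * (-1) ^ card H * q (int (rk \<B> G)) * q (- int (rk \<B> U)) * full_support_series \<B> H)"
    unfolding weight_series_eq[OF assms]
    by (rule sum.cong[OF refl])
      (simp add: relative_char_eq assms const sum_distrib_right sgn q_def flip: fps_const_mult)
  \<comment> \<open>Exchanging the sums over chains \<open>H \<subseteq> U \<subseteq> G\<close>
    leaves \<open>alternating_series \<B> U\<close> as the inner sum.\<close>
  also have "\<dots> = (\<Sum>U\<in>Pow G. \<Sum>H | H \<in> Pow G \<and> H \<subseteq> U.
      (-1) ^ card U * (-1) ^ card H * q (int (rk \<B> G)) * q (- int (rk \<B> U)) * full_support_series \<B> H)"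
    using assms by (intro sum.swap_restrict) auto
  also have "\<dots> = (\<Sum>U\<in>Pow G. q (int (rk \<B> G)) * (q (- int (rk \<B> U)) * alternating_series \<B> U))"
  proof (rule sum.cong[OF refl])
    fix U assume "U \<in> Pow G"
    then have "{H. H \<in> Pow G \<and> H \<subseteq> U} = Pow U" by auto
    then show "(\<Sum>H | H \<in> Pow G \<and> H \<subseteq> U.
        (-1) ^ card U * (-1) ^ card H * q (int (rk \<B> G)) * q (- int (rk \<B> U)) * full_support_series \<B> H)
      = q (int (rk \<B> G)) * (q (- int (rk \<B> U)) * alternating_series \<B> U)"
      by (simp only: alternating_series_def sum_distrib_left) (simp add: mult_ac)
  qed
  finally show ?thesis by (simp add: q_def sum_distrib_left)
qed

text \<open>Both sides are \<open>full_support_series \<B> G\<close>: by inversion, and by its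
  definition, where the two powers of \<open>q\<close> for \<open>rk \<B> G\<close> cancel.\<close>

lemma alternating_series_rec:
  assumes "finite G"
  shows "(\<Sum>U\<in>Pow G. alternating_series \<B> U) = fps_X ^ card G
    * (\<Sum>U\<in>Pow G. fps_const (var_q powi (- int (rk \<B> U))) * alternating_series \<B> U)"
proof -
  have "fps_const (var_q powi (- int (rk \<B> G))) * fps_const (var_q powi int (rk \<B> G)) = 1"
    by (simp add: var_q_nonzero power_int_minus)
  then show ?thesis
    unfolding sum_alternating_series[OF assms] full_support_series_def
      weight_series_alternating[OF assms]
    by (metis (no_types, lifting) mult.assoc mult.commute mult_1)
qed

lemma rk_empty: "rk \<B> {} = 0"
  using bases_nonempty by (simp add: rk_def image_constant_conv)

text \<open>The start of the recursion: the zero function is the only weight supported on the empty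
  set.\<close>

lemma alternating_series_empty: "alternating_series \<B> {} = 1"
proof -
  have "weights ({} :: 'a set) n = (if n = 0 then {\<lambda>_. 0} else {})" for n
    by (auto simp: weights_def)
  moreover have "wt \<B> (\<lambda>_. 0 :: int) = 0"
    using bases_nonempty by (simp add: wt_def image_constant_conv)
  moreover have "matroid_char_poly {} \<A> = 1" for \<A> :: "'a set set"
    by (simp add: matroid_char_poly_def one_pCons monom_0)
  ultimately have "weight_series \<B> {} = 1"
    by (intro fps_ext) (simp add: weight_series_def weight_term_def)
  then show ?thesis
    by (simp add: alternating_series_def full_support_series_def rk_empty)
qed

text \<open>Each class has a unique representative with minimum 0, that is, a nonnegative weight
  whose support is not all of \<open>E\<close>. Hence the full-support part is subtracted.\<close>

lemma zeta_series_eq: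
  assumes "E \<noteq> {}"
  shows "zeta_series E \<B> = fps_const (var_q powi (1 - int (rk \<B> E)) / (var_q - 1))
    * (weight_series \<B> E - full_support_series \<B> E)"
proof (rule fps_ext)
  fix n
  define k where "k = var_q powi (1 - int (rk \<B> E)) / (var_q - 1)"
  define norm where "norm v = (\<lambda>e. if e \<in> E then lift v e - Min (lift v ` E) else 0)" for v
  have q1: "var_q - 1 = to_fract [:-1, 1:]" "var_q - 1 \<noteq> 0"
    using var_q_minus_one by simp_all
  \<comment> \<open>For such weights the reduced size and reduced weight are the plain ones.\<close>
  have Min0: "Min (w ` E) = 0" if w: "w \<in> weights E n" "support w \<noteq> E" for w
  proof -
    obtain e where "e \<in> E" "w e = 0" using w support_weights[OF w(1)] by (auto simp: support_def)
    then show ?thesis using w finite_ground by (intro Min_eqI) (auto simp: weights_def)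
  qed
  have norm: "(lift v, restrict (norm v) E) \<in> shift_rel E" "v = shift_rel E `` {restrict (norm v) E}"
    if v: "v \<in> int_lattice_mod_ones E" for v
  proof -
    have "lift v \<in> int_lattice E"
      using lift_shift_rel[OF v lift_in[OF v]] by (simp add: shift_rel_def)
    then show *: "(lift v, restrict (norm v) E) \<in> shift_rel E"
      by (auto simp: shift_rel_def int_lattice_def norm_def intro!: exI[of _ "- Min (lift v ` E)"])
    show "v = shift_rel E `` {restrict (norm v) E}"
    proof (rule quotient_eqI[OF equiv_shift_rel _ _ lift_in[OF v] _ *])
      have lat: "restrict (norm v) E \<in> int_lattice E" by (simp add: int_lattice_def)
      then show "shift_rel E `` {restrict (norm v) E} \<in> int_lattice E // shift_rel E"
        by (rule quotientI)
      show "restrict (norm v) E \<in> shift_rel E `` {restrict (norm v) E}"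
        using lat by (rule equiv_class_self[OF equiv_shift_rel])
      show "v \<in> int_lattice E // shift_rel E" using v by (simp add: int_lattice_mod_ones_def)
    qed
  qed
  have norm_weights: "norm v \<in> weights E n" "support (norm v) \<noteq> E"
    if v: "reduced_size E (lift v) = int n" for v
  proof -
    have "(\<Sum>e\<in>E. norm v e) = int n"
      using v by (simp add: norm_def reduced_size_def sum_subtractf)
    then show "norm v \<in> weights E n" using finite_ground by (auto simp: norm_def weights_def)
    have "Min (lift v ` E) \<in> lift v ` E" using assms finite_ground by (intro Min_in) auto
    then obtain e where "e \<in> E" "lift v e = Min (lift v ` E)" by auto
    then have "e \<in> E" "e \<notin> support (norm v)" by (simp_all add: norm_def support_def)
    then show "support (norm v) \<noteq> E" by blast
  qed
  have "zeta_series E \<B> $ n = (\<Sum>w | w \<in> weights E n \<and> support w \<noteq> E. k * weight_term \<B> E w)"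
    unfolding zeta_series_def fps_nth_Abs_fps
  proof (rule sum.reindex_bij_witness[of _ "\<lambda>w. shift_rel E `` {restrict w E}" norm])
    fix v assume "v \<in> {v. v \<in> int_lattice_mod_ones E \<and> reduced_size E (lift v) = int n}"
    then have v: "v \<in> int_lattice_mod_ones E" "reduced_size E (lift v) = int n" by auto
    show "shift_rel E `` {restrict (norm v) E} = v" using norm(2)[OF v(1)] by simp
    show "norm v \<in> {w. w \<in> weights E n \<and> support w \<noteq> E}" using norm_weights v by simp
    have same: "wt \<B> (restrict (norm v) E) = wt \<B> (norm v)"
        "initial_bases \<B> (restrict (norm v) E) = initial_bases \<B> (norm v)"
      by (intro initial_bases_cong; simp)+
    have "Min (restrict (norm v) E ` E) = 0"
      using Min0[OF norm_weights[OF v(2)]] by (simp cong: image_cong)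
    then have rwt: "reduced_wt E \<B> (lift v) = wt \<B> (norm v)"
      using reduced_wt_shift[OF assms norm(1)[OF v(1)]] same by (simp add: reduced_wt_def)
    have init: "initial_bases \<B> (lift v) = initial_bases \<B> (norm v)"
      using initial_bases_shift[OF norm(1)[OF v(1)]] same by simp
    \<comment> \<open>Exact division: the factor \<open>var_q - 1\<close> cancels the denominator of
      \<open>k\<close>.\<close>
    have "to_fract (matroid_char_poly E (initial_bases \<B> (norm v)))
        = (var_q - 1) * to_fract (reduced_char_poly E (initial_bases \<B> (norm v)))"
      using reduced_char_poly_mult[OF finite_ground assms]
      unfolding q1(1) by (metis to_fract_mult)
    moreover have "var_q powi (- (int (rk \<B> E) - 1) - wt \<B> (norm v))
        = var_q powi (1 - int (rk \<B> E)) * var_q powi (- wt \<B> (norm v))"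
      using var_q_nonzero by (simp flip: power_int_add)
    ultimately show "k * weight_term \<B> E (norm v) = zeta_term E \<B> (lift v)"
      unfolding zeta_term_def weight_term_def rwt init k_def using q1(2) by simp
  next
    fix w assume "w \<in> {w. w \<in> weights E n \<and> support w \<noteq> E}"
    then have w: "w \<in> weights E n" "support w \<noteq> E" by auto
    let ?v = "shift_rel E `` {restrict w E}"
    have lat: "restrict w E \<in> int_lattice E" by (simp add: int_lattice_def)
    then show v: "?v \<in> {v. v \<in> int_lattice_mod_ones E \<and> reduced_size E (lift v) = int n}"
    proof -
      have v: "?v \<in> int_lattice_mod_ones E"
        using lat by (simp add: int_lattice_mod_ones_def quotientI)
      have "(restrict w E, lift ?v) \<in> shift_rel E" using lift_in[OF v] by simp
      then have "reduced_size E (lift ?v) = reduced_size E (restrict w E)"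
        by (rule reduced_size_shift[OF finite_ground assms])
      also have "\<dots> = int n"
        using Min0[OF w] w(1) by (simp add: reduced_size_def weights_def cong: image_cong)
      finally show ?thesis using v by simp
    qed
    then have "(restrict w E, lift ?v) \<in> shift_rel E" using lift_in[of ?v E] by simp
    moreover have "\<exists>c. \<forall>e\<in>E. w' e = w e + c" if "(restrict w E, w') \<in> shift_rel E" for w'
      using that by (auto simp: shift_rel_def)
    \<comment> \<open>The chosen lift differs from \<open>w\<close> by a constant, which subtracting
      the minimum removes.\<close>
    ultimately obtain c where c: "\<forall>e\<in>E. lift ?v e = w e + c" by blast
    show "norm ?v = w"
    proof
      fix e
      show "norm ?v e = w e"
        using c w(1) Min_shift[OF finite_ground assms c] Min0[OF w]
        by (cases "e \<in> E") (auto simp: norm_def weights_def)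
    qed
  qed
  also have "\<dots> = k * ((\<Sum>w\<in>weights E n. weight_term \<B> E w)
      - (\<Sum>w | w \<in> weights E n \<and> support w = E. weight_term \<B> E w))"
  proof -
    have "{w. w \<in> weights E n \<and> support w \<noteq> E} = weights E n - {w. w \<in> weights E n \<and> support w = E}"
      by auto
    then show ?thesis
      using finite_weights[OF finite_ground] by (simp add: sum_diff flip: sum_distrib_left)
  qed
  also have "(\<Sum>w | w \<in> weights E n \<and> support w = E. weight_term \<B> E w)
      = full_support_series \<B> E $ n"
  proof -
    \<comment> \<open>Only \<open>U = E\<close> remains, so the relative factor is 1.\<close>
    have "{U. U \<in> Pow E \<and> E \<subseteq> U} = {E}" by auto
    then have "relative_char \<B> E E = 1" by (simp add: relative_char_def monom_0 flip: one_pCons)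
    then show ?thesis using sum_support_weight_term[OF finite_ground order_refl] by simp
  qed
  finally show "zeta_series E \<B> $ n = (fps_const (var_q powi (1 - int (rk \<B> E)) / (var_q - 1))
      * (weight_series \<B> E - full_support_series \<B> E)) $ n"
    by (simp add: k_def weight_series_def)
qed

end

section \<open>The functional equation\<close>

theorem theorem1p2:
  fixes E :: "'a set" and \<B> :: "'a set set"
  assumes "matroid E \<B>" and "E \<noteq> {}"
  shows "expands_to (reduced_zeta E \<B>) (zeta_series E \<B>) \<and>
    invert_qT (reduced_zeta E \<B>) = const_T (var_q powi (int (rk \<B> E) - 1)) * reduced_zeta E \<B>"
proof -
  interpret matroid E \<B> by fact
  note inv = inj_ring_hom_invert_qT and const = inj_ring_hom_const_T
  define V where "V = alternating_series \<B>"
  define r where "r = int (rk \<B> E)"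
  have "\<exists>R. expands_to R (V U) \<and> invert_qT R = const_T (var_q powi (- int (rk \<B> U))) * R"
    if "finite U" for U
    unfolding V_def
    by (intro self_dual_expansion alternating_series_rec that)
      (simp_all add: alternating_series_empty rk_empty)
  then obtain R where R: "expands_to (R U) (V U)"
      "invert_qT (R U) = const_T (var_q powi (- int (rk \<B> U))) * R U" if "U \<in> Pow E" for U
    using finite_ground finite_subset by (metis PowD)
  define A where "A = (\<Sum>U\<in>Pow E. R U)"
  define A' where "A' = (\<Sum>U\<in>Pow E. const_T (var_q powi (- int (rk \<B> U))) * R U)"
  define q where "q = const_T var_q"
  have q_powi: "const_T (var_q powi k) = q powi k" for k
    by (simp add: q_def inj_ring_hom_power_int[OF const])
  have q_nz: "q \<noteq> 0" using inj_ring_hom.hom_inj[OF const] var_q_nonzero by (auto simp: q_def)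
  have q1: "q - 1 \<noteq> 0"
    using inj_ring_hom.hom_inj[OF const, of "var_q - 1"] var_q_minus_one(2)
    by (simp only: q_def inj_ring_hom.hom_diff[OF const] inj_ring_hom.hom_one[OF const]) auto
  have inv_q: "invert_qT q = inverse q"
    by (simp add: q_def invert_qT_const_T invert_q_var_q inj_ring_hom_inverse[OF const])
  have inv_A: "invert_qT A = A'"
    unfolding A_def A'_def inj_ring_hom.hom_sum[OF inv] by (intro sum.cong R refl)
  \<comment> \<open>As in the induction, but with the sums now running over all subsets of
    \<open>E\<close>.\<close>
  have inv_A': "invert_qT A' = A"
    unfolding A_def A'_def inj_ring_hom.hom_sum[OF inv]
    by (rule sum.cong[OF refl])
      (simp add: R inj_ring_hom.hom_mult[OF inv] inj_ring_hom.hom_power[OF inv]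
        inj_ring_hom_inverse[OF inv] inj_ring_hom_inverse[OF const] inj_ring_hom.hom_power[OF const]
        power_int_minus inv_q q_nz power_inverse flip: q_def)
  \<comment> \<open>\<open>zeta_series_eq\<close> with \<open>q powi r * A'\<close> for the sum over
    all weights and \<open>A\<close> for the full-support part.\<close>
  define Z where "Z = q powi (1 - r) / (q - 1) * (q powi r * A' - A)"
  have "expands_to (const_T (var_q powi (1 - r) / (var_q - 1))
      * (const_T (var_q powi r) * A' - A)) (zeta_series E \<B>)"
    unfolding zeta_series_eq[OF assms(2)] weight_series_alternating[OF finite_ground]
      sum_alternating_series[OF finite_ground, symmetric] A_def A'_def r_def V_def[symmetric]
    by (intro expands_to_mult expands_to_const expands_to_diff expands_to_sum R)
  then have Z: "expands_to Z (zeta_series E \<B>)"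
    by (simp add: Z_def q_powi inj_ring_hom_divide[OF const] inj_ring_hom.hom_diff[OF const]
        inj_ring_hom.hom_one[OF const] flip: q_def)
  then have zeta: "reduced_zeta E \<B> = Z"
    unfolding reduced_zeta_def using expands_to_unique by blast
  have "invert_qT Z = inverse q powi (1 - r) / (inverse q - 1) * (inverse q powi r * A - A')"
    by (simp add: Z_def inj_ring_hom.hom_mult[OF inv] inj_ring_hom_divide[OF inv]
        inj_ring_hom.hom_diff[OF inv] inj_ring_hom_power_int[OF inv] inj_ring_hom.hom_one[OF inv]
        inv_q inv_A inv_A')
  also have "\<dots> = q powi (r - 1) * Z"
  proof -
    \<comment> \<open>With \<open>Q\<close> for \<open>q powi r\<close>, both sides become
      \<open>(Q * A' - A) / (q - 1)\<close>.\<close>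
    define Q where "Q = q powi r"
    have Q: "Q \<noteq> 0" "q powi (1 - r) = q / Q" "q powi (r - 1) = Q / q"
        "inverse q powi (1 - r) = Q / q" "inverse q powi r = inverse Q"
      using q_nz by (simp_all add: Q_def power_int_diff power_int_inverse)
    have "inverse q - 1 = - (q - 1) / q" using q_nz by (simp add: field_simps)
    then show ?thesis
      unfolding Z_def Q Q_def[symmetric] using q_nz q1 Q(1)
      by (simp add: divide_simps) (simp add: algebra_simps)
  qed
  finally show ?thesis using Z zeta by (simp add: q_powi r_def)
qed

end
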